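(* For any $\eta\in(0,3)$, the stepsize pattern $h=(3-\eta,1.5)$ is straightforward. Hence, for every convex $L$-smooth $f:\mathbb{R}^n\to\mathbb{R}$ with minimizer $x_\star$ and every $x_0\in\mathbb{R}^n$ with $D=\sup\{\|x-x_\star\|_2\mid f(x)\le f(x_0)\}<\infty$, gradient descent $x_{k+1}=x_k-\frac{h_{(k\bmod 2)}}{L}\nabla f(x_k)$ alternating between these two stepsizes has, for every even $T$, $$ f(x_T)-f(x_\star)\le\frac{LD^2}{(2.25-\eta/2)\times T}+O(1/T^2).$$
   Context: $L$-smooth means differentiable with $L$-Lipschitz gradient ($L>0$, Euclidean norm). Straightforwardness: for a pattern $h=(h_0,\dots,h_{t-1})\in\mathbb{R}^t$, problem dimension $n$, and $L,D>0$, $p_{L,D}(\delta)$ is the supremum of $f(x_t)-f(x_\star)$ over all convex $L$-smooth $f:\mathbb{R}^n\to\mathbb{R}$ and $x_0,x_\star\in\mathbb{R}^n$ with $\nabla f(x_\star)=0$, $\|x_0-x_\star\|_2\le D$, $f(x_0)-f(x_\star)\le\delta$, where $x_{k+1}=x_k-\frac{h_k}{L}\nabla f(x_k)$ for $k=0,\dots,t-1$. $h$ is straightforward if for some $\Delta\in(0,1/2]$ and any $L,D>0$, $p_{L,D}(\delta)\le\delta-\frac{\sum_{i=0}^{t-1}h_i}{LD^2}\delta^2$ for all $\delta\in[0,LD^2\Delta]$. Convention: "$f(x_T)-f(x_\star)\le\frac{LD^2}{cT}+O(1/T^2)$ for every $T=st$" (here $t=2$) abbreviates that there exist universal constants $\bar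 s$ and $C$ (depending only on the pattern) such that $f(x_T)-f(x_\star)\le\frac{LD^2}{cT-C}$ for all $T=st$ with $s>\bar s$. *)

theory Defs
  imports "HOL-Analysis.Analysis"
begin

text \<open>
  The constants in the final rate depend on the stepsize pattern only, hence not on the dimension
  of the problem. The dimension therefore has to be a bound natural number and cannot be encoded in
  a type: all spaces \<open>\<real>\<^sup>n\<close> are realised as the coordinate subspaces
  \<open>Rn n = {x. \<forall>i \<ge> n. x\<^sub>i = 0}\<close> of one inner product space, the finitely supported real sequences
  with the Euclidean inner product. The lemmas \<open>Rn_coordinates\<close> and \<open>Rn_inner\<close> identify \<open>Rn n\<close> with
  Euclidean \<open>n\<close>-space.
\<close>

typedef fsvec = "{x :: nat \<Rightarrow> real. finite {i. x i \<noteq> 0}}"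
  morphisms coord Abs_fsvec
  by (rule exI[of _ "\<lambda>_. 0"]) simp

setup_lifting type_definition_fsvec

lemma finite_coord [simp]: "finite {i. coord x i \<noteq> 0}"
  using coord by simp

lemma fsvec_eq_iff: "x = y \<longleftrightarrow> (\<forall>i. coord x i = coord y i)"
  by (metis coord_inject ext)

instantiation fsvec :: real_vector
begin

lift_definition zero_fsvec :: fsvec is "\<lambda>_. 0"
  by simp

lift_definition plus_fsvec :: "fsvec \<Rightarrow> fsvec \<Rightarrow> fsvec" is "\<lambda>x y i. x i + y i"
proof -
  fix x y :: "nat \<Rightarrow> real"
  assume "finite {i. x i \<noteq> 0}" "finite {i. y i \<noteq> 0}"
  then have "finite ({i. x i \<noteq> 0} \<union> {i. y i \<noteq> 0})" by simp
  then show "finite {i. x i + y i \<noteq> 0}" by (rule rev_finite_subset) auto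
qed

lift_definition minus_fsvec :: "fsvec \<Rightarrow> fsvec \<Rightarrow> fsvec" is "\<lambda>x y i. x i - y i"
proof -
  fix x y :: "nat \<Rightarrow> real"
  assume "finite {i. x i \<noteq> 0}" "finite {i. y i \<noteq> 0}"
  then have "finite ({i. x i \<noteq> 0} \<union> {i. y i \<noteq> 0})" by simp
  then show "finite {i. x i - y i \<noteq> 0}" by (rule rev_finite_subset) auto
qed

lift_definition uminus_fsvec :: "fsvec \<Rightarrow> fsvec" is "\<lambda>x i. - x i"
  by simp

lift_definition scaleR_fsvec :: "real \<Rightarrow> fsvec \<Rightarrow> fsvec" is "\<lambda>c x i. c * x i"
  by (rule finite_subset) auto

instance
  by standard (transfer; force simp: algebra_simps)+

end

lemma coord_simps [simp]:
  "coord 0 i = 0"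
  "coord (x + y) i = coord x i + coord y i"
  "coord (x - y) i = coord x i - coord y i"
  "coord (- x) i = - coord x i"
  "coord (c *\<^sub>R x) i = c * coord x i"
  by (transfer; simp)+

instantiation fsvec :: real_inner
begin

definition inner_fsvec :: "fsvec \<Rightarrow> fsvec \<Rightarrow> real"
  where "inner_fsvec x y = (\<Sum>i | coord x i \<noteq> 0. coord x i * coord y i)"

definition norm_fsvec :: "fsvec \<Rightarrow> real"
  where "norm_fsvec x = sqrt (inner x x)"

definition sgn_fsvec :: "fsvec \<Rightarrow> fsvec"
  where "sgn_fsvec x = x /\<^sub>R norm x"

definition dist_fsvec :: "fsvec \<Rightarrow> fsvec \<Rightarrow> real"
  where "dist_fsvec x y = norm (x - y)"

definition uniformity_fsvec :: "(fsvec \<times> fsvec) filter"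
  where "uniformity_fsvec = (INF e\<in>{0<..}. principal {(x, y). dist x y < e})"

definition open_fsvec :: "fsvec set \<Rightarrow> bool"
  where "open_fsvec U \<longleftrightarrow> (\<forall>x\<in>U. \<forall>\<^sub>F (x', y) in uniformity. x' = x \<longrightarrow> y \<in> U)"

lemma inner_fsvec_superset:
  "inner x y = (\<Sum>i\<in>A. coord x i * coord y i)" if "finite A" "{i. coord x i \<noteq> 0} \<subseteq> A" for x y :: fsvec
  unfolding inner_fsvec_def by (rule sum.mono_neutral_left) (use that in auto)

instance
proof
  fix x y z :: fsvec and r :: real
  define A where "A = {i. coord x i \<noteq> 0} \<union> {i. coord y i \<noteq> 0} \<union> {i. coord (x + y) i \<noteq> 0}"
  have A: "finite A" by (simp add: A_def del: coord_simps)
  show "inner x y = inner y x"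
    using A by (subst (1 2) inner_fsvec_superset[of A]) (auto simp: A_def mult.commute)
  show "inner (x + y) z = inner x z + inner y z"
    using A by (subst (1 2 3) inner_fsvec_superset[of A]) (auto simp: A_def distrib_right sum.distrib)
  show "inner (r *\<^sub>R x) y = r * inner x y"
    using A by (subst (1 2) inner_fsvec_superset[of A]) (auto simp: A_def sum_distrib_left mult_ac)
  show "0 \<le> inner x x"
    by (simp add: inner_fsvec_def sum_nonneg)
  show "inner x x = 0 \<longleftrightarrow> x = 0"
    unfolding inner_fsvec_def by (subst sum_nonneg_eq_0_iff) (auto simp: fsvec_eq_iff)
qed (simp_all add: norm_fsvec_def sgn_fsvec_def dist_fsvec_def uniformity_fsvec_def open_fsvec_def)

end

definition Rn :: "nat \<Rightarrow> fsvec set"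
  where "Rn n = {x. \<forall>i\<ge>n. coord x i = 0}"

lemma subspace_Rn: "subspace (Rn n)"
  by (auto simp: subspace_def Rn_def)

lemma Rn_coordinates: "\<exists>!x. x \<in> Rn n \<and> (\<forall>i<n. coord x i = a i)"
proof
  have "finite {i. (if i < n then a i else 0) \<noteq> 0}"
    by (rule finite_subset[of _ "{..<n}"]) auto
  then show "Abs_fsvec (\<lambda>i. if i < n then a i else 0) \<in> Rn n \<and>
      (\<forall>i<n. coord (Abs_fsvec (\<lambda>i. if i < n then a i else 0)) i = a i)"
    by (simp add: Rn_def Abs_fsvec_inverse)
next
  fix x assume x: "x \<in> Rn n \<and> (\<forall>i<n. coord x i = a i)"
  have "finite {i. (if i < n then a i else 0) \<noteq> 0}"
    by (rule finite_subset[of _ "{..<n}"]) auto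
  with x show "x = Abs_fsvec (\<lambda>i. if i < n then a i else 0)"
    by (auto simp: fsvec_eq_iff Rn_def Abs_fsvec_inverse)
qed

lemma Rn_inner: "x \<in> Rn n \<Longrightarrow> inner x y = (\<Sum>i<n. coord x i * coord y i)"
  by (rule inner_fsvec_superset) (auto simp: Rn_def not_le[symmetric])

text \<open>
  A function \<open>f :: fsvec \<Rightarrow> real\<close> stands for its restriction to \<open>Rn n\<close>; its values elsewhere are
  irrelevant, since derivatives are taken within \<open>Rn n\<close>.
\<close>

definition is_gradient :: "nat \<Rightarrow> (fsvec \<Rightarrow> real) \<Rightarrow> fsvec \<Rightarrow> fsvec \<Rightarrow> bool"
  where "is_gradient n f x g \<longleftrightarrow>
    g \<in> Rn n \<and> (f has_derivative (\<lambda>v. inner g v)) (at x within Rn n)"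

definition grad :: "nat \<Rightarrow> (fsvec \<Rightarrow> real) \<Rightarrow> fsvec \<Rightarrow> fsvec"
  where "grad n f x = (THE g. is_gradient n f x g)"

definition L_smooth :: "nat \<Rightarrow> real \<Rightarrow> (fsvec \<Rightarrow> real) \<Rightarrow> bool"
  where "L_smooth n L f \<longleftrightarrow>
    L > 0 \<and> (\<forall>x\<in>Rn n. \<exists>g. is_gradient n f x g) \<and> L-lipschitz_on (Rn n) (grad n f)"

lemma is_gradient_unique:
  assumes "is_gradient n f x g" "is_gradient n f x g'" "x \<in> Rn n"
  shows "g = g'"
proof -
  define d where "d = g - g'"
  have d: "d \<in> Rn n"
    using assms subspace_diff[OF subspace_Rn] by (auto simp: d_def is_gradient_def)
  have 0: "((\<lambda>y. 0) has_derivative (\<lambda>v. inner d v)) (at x within Rn n)"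
    using has_derivative_diff[of f "\<lambda>v. inner g v" "at x within Rn n" f "\<lambda>v. inner g' v"] assms
    by (simp add: is_gradient_def d_def inner_diff_left)
  have line: "((\<lambda>t. x + t *\<^sub>R d) has_derivative (\<lambda>t. t *\<^sub>R d)) (at (0::real))"
    by (auto intro!: derivative_eq_intros)
  have "range (\<lambda>t. x + t *\<^sub>R d) \<subseteq> Rn n"
    using assms d subspace_Rn by (auto intro!: subspace_add subspace_scale)
  then have "((\<lambda>y. 0) has_derivative (\<lambda>v. inner d v)) (at (x + 0 *\<^sub>R d) within range (\<lambda>t. x + t *\<^sub>R d))"
    using has_derivative_subset[OF 0] by simp
  from diff_chain_within[OF line this]
  have "((\<lambda>t. 0) has_derivative (\<lambda>t. inner d (t *\<^sub>R d))) (at (0::real))"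
    by (simp add: o_def)
  then have "(\<lambda>t::real. inner d (t *\<^sub>R d)) = (\<lambda>t. 0)"
    using has_derivative_const by (rule has_derivative_unique)
  then have "inner d (1 *\<^sub>R d) = 0" by meson
  then show ?thesis by (simp add: d_def)
qed

lemma grad_eqI: "is_gradient n f x g \<Longrightarrow> x \<in> Rn n \<Longrightarrow> grad n f x = g"
  unfolding grad_def by (blast intro: is_gradient_unique)

text \<open>Gradient descent on \<open>\<real>\<^sup>n\<close> with the normalised stepsizes \<open>h 0, h 1, \<dots>\<close>.\<close>

primrec gd :: "nat \<Rightarrow> real \<Rightarrow> (nat \<Rightarrow> real) \<Rightarrow> (fsvec \<Rightarrow> real) \<Rightarrow> fsvec \<Rightarrow> nat \<Rightarrow> fsvec"
  where
    "gd n L h f x0 0 = x0"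
  | "gd n L h f x0 (Suc k) = gd n L h f x0 k - (h k / L) *\<^sub>R grad n f (gd n L h f x0 k)"

definition worst_case :: "nat \<Rightarrow> real list \<Rightarrow> real \<Rightarrow> real \<Rightarrow> real \<Rightarrow> ereal"
  where "worst_case n h L D \<delta> =
    Sup {ereal (f (gd n L (\<lambda>k. h ! k) f x0 (length h)) - f xs) | f x0 xs.
      convex_on (Rn n) f \<and> L_smooth n L f \<and> x0 \<in> Rn n \<and> xs \<in> Rn n \<and>
      grad n f xs = 0 \<and> norm (x0 - xs) \<le> D \<and> f x0 - f xs \<le> \<delta>}"

text \<open>The threshold \<open>\<Delta>\<close> is a property of the pattern alone: it serves all dimensions.\<close>

definition straightforward :: "real list \<Rightarrow> bool"
  where "straightforward h \<longleftrightarrow>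
    (\<exists>\<Delta>. 0 < \<Delta> \<and> \<Delta> \<le> 1 / 2 \<and>
      (\<forall>n\<ge>1. \<forall>L>0. \<forall>D>0. \<forall>\<delta>\<in>{0..L * D\<^sup>2 * \<Delta>}.
        worst_case n h L D \<delta> \<le> ereal (\<delta> - (\<Sum>i<length h. h ! i) / (L * D\<^sup>2) * \<delta>\<^sup>2)))"

end

theory Submission
  imports Defs
begin

text \<open>
  With \<open>L = 1\<close> and gradients \<open>g\<^sub>0, g\<^sub>1, g\<^sub>2\<close> at three consecutive iterates, combining the interpolation
  inequalities for the pairs \<open>(0,1)\<close>, \<open>(1,2)\<close>, \<open>(0,2)\<close> with weights close to \<open>1/2\<close> bounds the decrease
  \<open>f(x\<^sub>0) - f(x\<^sub>2)\<close> below by \<open>c |g|\<^sup>2 + \<sigma> d\<close>. Here \<open>c = 9/2 - \<eta>\<close> is the sum of the stepsizes, \<open>g\<close> a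
  convex combination of the three gradients, and \<open>d = |g\<^sub>0 - g\<^sub>1|\<^sup>2 + |g\<^sub>1 - g\<^sub>2|\<^sup>2\<close>. Combining the
  inequalities towards the minimizer with the same convex weights gives
  \<open>f(x\<^sub>0) - f(x\<^sub>\<star>) \<le> |g| |x\<^sub>0 - x\<^sub>\<star>| + K d\<close>. For a small gap the error \<open>K d\<close> is absorbed by \<open>\<sigma> d\<close>,
  and the decrease is at least \<open>c (f(x\<^sub>0) - f(x\<^sub>\<star>))\<^sup>2 / D\<^sup>2\<close>.
\<close>

section \<open>Inequalities between the gradients at three consecutive iterates\<close>

text \<open>The weights \<open>1/2 + \<epsilon>, 1/2 + \<epsilon>, 1/2 - \<epsilon>\<close> produce the quadratic form \<open>q\<close> of the proof. At
  \<open>\<epsilon> = 0\<close> its excess over the square of the averaged gradient vanishes in the direction \<open>G1 - G2\<close>;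
  the perturbation \<open>\<epsilon>\<close> makes it positive definite in the gradient differences.\<close>

lemma gap_lower_bound:
  fixes G0 G1 G2 :: "'a::real_inner" and \<eta> F0 F1 F2 :: real
  defines "\<epsilon> \<equiv> \<eta> / 200" and "c \<equiv> 9 / 2 - \<eta>"
  assumes \<eta>: "0 < \<eta>" "\<eta> < 3"
    and Q01: "(3 - \<eta>) * inner G0 G1 + (norm (G0 - G1))\<^sup>2 / 2 \<le> F0 - F1"
    and Q12: "3 / 2 * inner G1 G2 + (norm (G1 - G2))\<^sup>2 / 2 \<le> F1 - F2"
    and Q02: "inner G2 ((3 - \<eta>) *\<^sub>R G0 + (3 / 2) *\<^sub>R G1) + (norm (G0 - G2))\<^sup>2 / 2 \<le> F0 - F2"
  shows "(norm (((3 - \<eta>) / 2) *\<^sub>R G0 + (3 / 2 - \<eta> / 4 + \<epsilon> * (3 - \<eta>) / 2) *\<^sub>R G1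
            + (3 / 2 - \<eta> / 4 - \<epsilon> * (3 - \<eta>) / 2) *\<^sub>R G2))\<^sup>2
          + \<eta> / 1600 * ((norm (G0 - G1))\<^sup>2 + (norm (G1 - G2))\<^sup>2) \<le> c * (F0 - F2)"
    (is "(norm ?M)\<^sup>2 + _ * ?d \<le> _")
proof -
  \<comment> \<open>In the variables \<open>P\<close> and \<open>R\<close> the form is diagonal at
    \<open>\<epsilon> = 0\<close>: only the square of \<open>P\<close> remains next to that of the
    averaged gradient. The perturbation adds the cross term with coefficient \<open>\<beta>\<close>
    and a positive multiple of the square of \<open>R\<close>.\<close>
  define P where "P = G0 - (1 / 2) *\<^sub>R (G1 + G2)"
  define R where "R = G1 - G2"
  have \<epsilon>: "0 < \<epsilon>" "\<epsilon> < 1 / 50" using \<eta> by (auto simp: \<epsilon>_def)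
  have c: "3 / 2 < c" using \<eta> by (simp add: c_def)
  define q where "q = (1 / 2 + \<epsilon>) * ((3 - \<eta>) * inner G0 G1 + (norm (G0 - G1))\<^sup>2 / 2)
      + (1 / 2 + \<epsilon>) * (3 / 2 * inner G1 G2 + (norm (G1 - G2))\<^sup>2 / 2)
      + (1 / 2 - \<epsilon>) * (inner G2 ((3 - \<eta>) *\<^sub>R G0 + (3 / 2) *\<^sub>R G1) + (norm (G0 - G2))\<^sup>2 / 2)"
  have "q \<le> (1 / 2 + \<epsilon>) * (F0 - F1) + (1 / 2 + \<epsilon>) * (F1 - F2) + (1 / 2 - \<epsilon>) * (F0 - F2)"
    unfolding q_def using \<epsilon> by (intro add_mono mult_left_mono Q01 Q12 Q02) auto
  also have "\<dots> = F0 - F2" by (simp add: field_simps)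
  finally have qF: "q \<le> F0 - F2" .
  define \<beta> where "\<beta> = \<epsilon> * (9 / 2 - 7 / 2 * \<eta> + \<eta>\<^sup>2 / 2)"
  have id: "c * q = (norm ?M)\<^sup>2 + (\<eta> - \<eta>\<^sup>2 / 4) * (norm P)\<^sup>2 + \<beta> * inner P R
      + (2 * \<epsilon> * c - \<epsilon>\<^sup>2 * (3 - \<eta>)\<^sup>2) / 4 * (norm R)\<^sup>2"
    unfolding q_def P_def R_def c_def \<beta>_def power2_norm_eq_inner
    by (simp add: inner_simps inner_commute[of G1 G0] inner_commute[of G2 G0] inner_commute[of G2 G1]
        field_simps power2_eq_square)
  have b: "\<bar>9 / 2 - 7 / 2 * \<eta> + \<eta>\<^sup>2 / 2\<bar> \<le> 9 / 2"
    using \<eta> mult_nonneg_nonneg[of \<eta> "7 - \<eta>"] mult_nonneg_nonneg[of "3 - \<eta>" "4 - \<eta>"]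
    by (intro abs_leI) (simp_all add: algebra_simps power2_eq_square)
  \<comment> \<open>The split is lopsided on purpose. Per unit of \<open>\<epsilon>\<close>,
    \<open>R\<close> has only 1/2 to spend and loses 1/4. The heavy weight 81/4 falls on
    \<open>P\<close>, where \<open>\<epsilon> = \<eta> / 200\<close> turns it into 81/800 of
    \<open>\<eta>\<close>, less than 1/8. What is left is \<open>\<eta> / 8\<close> on
    \<open>P\<close> and \<open>\<epsilon> / 4 = \<eta> / 800\<close> on \<open>R\<close>.\<close>
  have AMGM: "9 / 2 * (norm P * norm R) \<le> (norm R)\<^sup>2 / 4 + 81 / 4 * (norm P)\<^sup>2"
    using zero_le_power2[of "norm R / 2 - 9 / 2 * norm P"] by (simp add: power2_eq_square algebra_simps)
  have "\<bar>\<beta> * inner P R\<bar> = \<epsilon> * (\<bar>9 / 2 - 7 / 2 * \<eta> + \<eta>\<^sup>2 / 2\<bar> * \<bar>inner P R\<bar>)"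
    using \<epsilon> by (simp add: \<beta>_def abs_mult)
  also have "\<dots> \<le> \<epsilon> * (9 / 2 * (norm P * norm R))"
    using \<epsilon> b Cauchy_Schwarz_ineq2[of P R] by (intro mult_left_mono mult_mono) auto
  also have "\<dots> \<le> \<epsilon> * ((norm R)\<^sup>2 / 4 + 81 / 4 * (norm P)\<^sup>2)"
    using \<epsilon> AMGM by (intro mult_left_mono) auto
  finally have cross: "- \<epsilon> * ((norm R)\<^sup>2 / 4 + 81 / 4 * (norm P)\<^sup>2) \<le> \<beta> * inner P R"
    by linarith
  have P2: "\<eta> / 4 * (norm P)\<^sup>2 \<le> (\<eta> - \<eta>\<^sup>2 / 4) * (norm P)\<^sup>2"
    using \<eta> mult_right_mono[of \<eta> 3 \<eta>]
    by (intro mult_right_mono) (auto simp: power2_eq_square)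
  have "\<epsilon> * (3 - \<eta>)\<^sup>2 \<le> 1 / 50 * 3\<^sup>2"
    using \<epsilon> \<eta> by (intro mult_mono power_mono) auto
  then have "2 \<le> 2 * c - \<epsilon> * (3 - \<eta>)\<^sup>2" using c by simp
  then have "\<epsilon> * 2 \<le> \<epsilon> * (2 * c - \<epsilon> * (3 - \<eta>)\<^sup>2)"
    using \<epsilon> by (intro mult_left_mono) auto
  then have "\<epsilon> / 2 \<le> (2 * \<epsilon> * c - \<epsilon>\<^sup>2 * (3 - \<eta>)\<^sup>2) / 4"
    by (simp add: power2_eq_square algebra_simps)
  then have R2: "\<epsilon> / 2 * (norm R)\<^sup>2 \<le> (2 * \<epsilon> * c - \<epsilon>\<^sup>2 * (3 - \<eta>)\<^sup>2) / 4 * (norm R)\<^sup>2"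
    by (intro mult_right_mono) auto
  have "(norm (G0 - G1))\<^sup>2 + (norm (G0 - G2))\<^sup>2 = 2 * (norm P)\<^sup>2 + (norm R)\<^sup>2 / 2"
    unfolding P_def R_def power2_norm_eq_inner
    by (simp add: inner_simps inner_commute[of G1 G0] inner_commute[of G2 G0] inner_commute[of G2 G1]
        field_simps)
  then have "(norm (G0 - G1))\<^sup>2 \<le> 2 * (norm P)\<^sup>2 + (norm R)\<^sup>2 / 2"
    using zero_le_power2[of "norm (G0 - G2)"] by linarith
  then have d: "?d \<le> 2 * (norm P)\<^sup>2 + 3 / 2 * (norm R)\<^sup>2" by (simp add: R_def)
  have nonneg: "0 \<le> \<eta> * (norm P)\<^sup>2" "0 \<le> \<eta> * (norm R)\<^sup>2" using \<eta> by auto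
  have "\<eta> / 1600 * ?d \<le> \<eta> / 1600 * (2 * (norm P)\<^sup>2 + 3 / 2 * (norm R)\<^sup>2)"
    using \<eta> d by (intro mult_left_mono) auto
  also have "\<dots> \<le> \<eta> / 8 * (norm P)\<^sup>2 + \<eta> / 800 * (norm R)\<^sup>2"
    using nonneg by (simp add: algebra_simps)
  also have "\<dots> \<le> (\<eta> - \<eta>\<^sup>2 / 4) * (norm P)\<^sup>2 + \<beta> * inner P R
      + (2 * \<epsilon> * c - \<epsilon>\<^sup>2 * (3 - \<eta>)\<^sup>2) / 4 * (norm R)\<^sup>2"
  proof -
    have "\<eta> / 8 * (norm P)\<^sup>2 + \<eta> / 800 * (norm R)\<^sup>2 \<le>
      \<eta> / 4 * (norm P)\<^sup>2 - \<epsilon> * ((norm R)\<^sup>2 / 4 + 81 / 4 * (norm P)\<^sup>2) + \<epsilon> / 2 * (norm R)\<^sup>2"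
      using nonneg by (simp add: \<epsilon>_def algebra_simps)
    then show ?thesis using cross P2 R2 by linarith
  qed
  finally have "(norm ?M)\<^sup>2 + \<eta> / 1600 * ?d \<le> c * q" using id by linarith
  also have "\<dots> \<le> c * (F0 - F2)" using qF c by (intro mult_left_mono) auto
  finally show ?thesis .
qed

text \<open>\<open>Q10\<close> and \<open>Q20\<close> turn the bounds on \<open>F1\<close> and
  \<open>F2\<close> into bounds on \<open>F0\<close>, so all three can be averaged. Expanded around
  \<open>G0\<close>, the average leaves \<open>G0\<close> paired with a vector in the gradient
  differences. The term \<open>- (norm G0)\<^sup>2 / 2\<close> pays for that pairing, and the rest
  is quadratic in the differences.\<close>

lemma value_upper_bound:
  fixes X G0 G1 G2 :: "'a::real_inner" and a b w0 w1 w2 F0 F1 F2 :: real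
  assumes a: "0 \<le> a" "a \<le> 3" and b: "0 \<le> b" "b \<le> 3 / 2"
    and w: "0 \<le> w0" "0 \<le> w1" "0 \<le> w2" "w0 + w1 + w2 = 1"
    and M0: "F0 \<le> inner G0 X - (norm G0)\<^sup>2 / 2"
    and M1: "F1 \<le> inner G1 (X - a *\<^sub>R G0) - (norm G1)\<^sup>2 / 2"
    and M2: "F2 \<le> inner G2 (X - a *\<^sub>R G0 - b *\<^sub>R G1) - (norm G2)\<^sup>2 / 2"
    and Q10: "F0 \<le> F1 + a * (norm G0)\<^sup>2"
    and Q20: "F0 \<le> F2 + inner G0 (a *\<^sub>R G0 + b *\<^sub>R G1)"
  shows "F0 \<le> inner (w0 *\<^sub>R G0 + w1 *\<^sub>R G1 + w2 *\<^sub>R G2) X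
    + 100 * ((norm (G0 - G1))\<^sup>2 + (norm (G1 - G2))\<^sup>2)"
proof -
  define p where "p = G0 - G1"
  define r where "r = G1 - G2"
  have G: "G1 = G0 - p" "G2 = G0 - p - r" by (auto simp: p_def r_def)
  define \<alpha> where "\<alpha> = w1 * (1 + a) + w2 * (1 + a + b)"
  define \<gamma> where "\<gamma> = w2 * (1 + a + b)"
  have "F0 = w0 * F0 + w1 * F0 + w2 * F0"
    using w by (metis distrib_right mult_1)
  also have "\<dots> \<le> w0 * (inner G0 X - (norm G0)\<^sup>2 / 2)
      + w1 * (inner G1 (X - a *\<^sub>R G0) - (norm G1)\<^sup>2 / 2 + a * (norm G0)\<^sup>2)
      + w2 * (inner G2 (X - a *\<^sub>R G0 - b *\<^sub>R G1) - (norm G2)\<^sup>2 / 2 + inner G0 (a *\<^sub>R G0 + b *\<^sub>R G1))"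
    using M0 M1 M2 Q10 Q20 w by (intro add_mono mult_left_mono) auto
  also have "\<dots> = inner (w0 *\<^sub>R G0 + w1 *\<^sub>R G1 + w2 *\<^sub>R G2) X - (w0 + w1 + w2) * (norm G0)\<^sup>2 / 2
      + inner G0 (\<alpha> *\<^sub>R p + \<gamma> *\<^sub>R r) - w1 * (norm p)\<^sup>2 / 2 - w2 * (norm (p + r))\<^sup>2 / 2
      - w2 * b * (norm p)\<^sup>2 - w2 * b * inner p r"
    unfolding G \<alpha>_def \<gamma>_def power2_norm_eq_inner
    by (simp add: inner_simps inner_commute[of p G0] inner_commute[of r G0] inner_commute[of r p]
        algebra_simps add_divide_distrib diff_divide_distrib)
  also have "(w0 + w1 + w2) * (norm G0)\<^sup>2 = (norm G0)\<^sup>2" using w by simp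
  finally have *: "F0 \<le> inner (w0 *\<^sub>R G0 + w1 *\<^sub>R G1 + w2 *\<^sub>R G2) X - (norm G0)\<^sup>2 / 2
      + inner G0 (\<alpha> *\<^sub>R p + \<gamma> *\<^sub>R r) - w2 * b * inner p r"
    using w b by (smt (verit) divide_nonneg_nonneg mult_nonneg_nonneg zero_le_power2)
  have AM: "inner G0 v \<le> (norm G0)\<^sup>2 / 2 + (norm v)\<^sup>2 / 2" for v
    using zero_le_power2[of "norm (G0 - v)"]
    by (simp only: power2_norm_eq_inner) (simp add: inner_simps inner_commute)
  have "w1 \<le> 1" "w2 \<le> 1" using w by auto
  have "\<gamma> \<le> 1 * (11 / 2)"
    unfolding \<gamma>_def using \<open>w2 \<le> 1\<close> w a b by (intro mult_mono) auto
  moreover have "w1 * (1 + a) \<le> 1 * 4" using \<open>w1 \<le> 1\<close> w a by (intro mult_mono) auto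
  ultimately have bd: "0 \<le> \<alpha>" "\<alpha> \<le> 19 / 2" "0 \<le> \<gamma>" "\<gamma> \<le> 11 / 2"
    using w a b by (auto simp: \<alpha>_def \<gamma>_def)
  have "(norm (\<alpha> *\<^sub>R p + \<gamma> *\<^sub>R r))\<^sup>2 = 2 * \<alpha>\<^sup>2 * (norm p)\<^sup>2 + 2 * \<gamma>\<^sup>2 * (norm r)\<^sup>2 - (norm (\<alpha> *\<^sub>R p - \<gamma> *\<^sub>R r))\<^sup>2"
    unfolding power2_norm_eq_inner
    by (simp add: inner_simps inner_commute[of r p] power2_eq_square algebra_simps)
  also have "\<dots> \<le> 2 * (19 / 2)\<^sup>2 * (norm p)\<^sup>2 + 2 * (11 / 2)\<^sup>2 * (norm r)\<^sup>2"
    using bd by (smt (verit) mult_left_mono mult_right_mono power_mono zero_le_power2)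
  finally have v: "(norm (\<alpha> *\<^sub>R p + \<gamma> *\<^sub>R r))\<^sup>2 \<le> 361 / 2 * (norm p)\<^sup>2 + 121 / 2 * (norm r)\<^sup>2"
    by (simp add: power2_eq_square)
  have "- inner p r \<le> (norm p)\<^sup>2 / 2 + (norm r)\<^sup>2 / 2"
    using zero_le_power2[of "norm (p + r)"]
    by (simp only: power2_norm_eq_inner) (simp add: inner_simps inner_commute)
  then have "w2 * b * (- inner p r) \<le> w2 * b * ((norm p)\<^sup>2 / 2 + (norm r)\<^sup>2 / 2)"
    using w b by (intro mult_left_mono) auto
  also have "\<dots> \<le> (1 * (3 / 2)) * ((norm p)\<^sup>2 / 2 + (norm r)\<^sup>2 / 2)"
    using w b \<open>w2 \<le> 1\<close> by (intro mult_right_mono mult_mono) auto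
  finally have "- (w2 * b * inner p r) \<le> 3 / 4 * (norm p)\<^sup>2 + 3 / 4 * (norm r)\<^sup>2" by simp
  \<comment> \<open>Half of \<open>v\<close> contributes 361/4 to the square of \<open>p\<close>,
    and the cross term another 3/4. The total 91, and the smaller one for \<open>r\<close>, are
    rounded up to 100.\<close>
  then have "F0 \<le> inner (w0 *\<^sub>R G0 + w1 *\<^sub>R G1 + w2 *\<^sub>R G2) X + 100 * ((norm p)\<^sup>2 + (norm r)\<^sup>2)"
    using * AM[of "\<alpha> *\<^sub>R p + \<gamma> *\<^sub>R r"] v zero_le_power2[of "norm p"] zero_le_power2[of "norm r"]
    by argo
  then show ?thesis by (simp add: p_def r_def)
qed

text \<open>The lower bound on the decrease and the upper bound on \<open>F0\<close> involve the
  same vector \<open>M\<close>. Squaring the latter and inserting the former eliminates it.\<close>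

lemma two_step_decrease:
  fixes X G0 G1 G2 :: "'a::real_inner" and \<eta> D F0 F1 F2 :: real
  assumes \<eta>: "0 < \<eta>" "\<eta> < 3" and D: "0 < D" "norm X \<le> D"
    and F0: "0 \<le> F0" "F0 \<le> D\<^sup>2 * (\<eta> / 10 ^ 7)"
    and Q01: "(3 - \<eta>) * inner G0 G1 + (norm (G0 - G1))\<^sup>2 / 2 \<le> F0 - F1"
    and Q12: "3 / 2 * inner G1 G2 + (norm (G1 - G2))\<^sup>2 / 2 \<le> F1 - F2"
    and Q02: "inner G2 ((3 - \<eta>) *\<^sub>R G0 + (3 / 2) *\<^sub>R G1) + (norm (G0 - G2))\<^sup>2 / 2 \<le> F0 - F2"
    and M0: "F0 \<le> inner G0 X - (norm G0)\<^sup>2 / 2"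
    and M1: "F1 \<le> inner G1 (X - (3 - \<eta>) *\<^sub>R G0) - (norm G1)\<^sup>2 / 2"
    and M2: "F2 \<le> inner G2 (X - (3 - \<eta>) *\<^sub>R G0 - (3 / 2) *\<^sub>R G1) - (norm G2)\<^sup>2 / 2"
    and Q10: "F0 \<le> F1 + (3 - \<eta>) * (norm G0)\<^sup>2"
    and Q20: "F0 \<le> F2 + inner G0 ((3 - \<eta>) *\<^sub>R G0 + (3 / 2) *\<^sub>R G1)"
  shows "F2 \<le> F0 - (9 / 2 - \<eta>) / D\<^sup>2 * F0\<^sup>2"
proof -
  define c where "c = 9 / 2 - \<eta>"
  define W where "W = (3 - \<eta>) / 2"
  define k where "k = \<eta> / 200 * (3 - \<eta>)"
  define W1 where "W1 = 3 / 2 - \<eta> / 4 + k / 2"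
  define W2 where "W2 = 3 / 2 - \<eta> / 4 - k / 2"
  define M where "M = W *\<^sub>R G0 + W1 *\<^sub>R G1 + W2 *\<^sub>R G2"
  define d where "d = (norm (G0 - G1))\<^sup>2 + (norm (G1 - G2))\<^sup>2"
  have c: "3 / 2 < c" "c < 9 / 2" and d: "0 \<le> d" using \<eta> by (auto simp: c_def d_def)
  have lower: "(norm M)\<^sup>2 + \<eta> / 1600 * d \<le> c * (F0 - F2)"
    using gap_lower_bound[OF \<eta> Q01 Q12 Q02] by (simp add: M_def W_def W1_def W2_def k_def d_def c_def)
  have "\<eta> / 200 * (3 - \<eta>) \<le> (1 / 50) * 3" using \<eta> by (intro mult_mono) auto
  then have k: "0 \<le> k" "k \<le> 3 / 50" using \<eta> by (simp_all add: k_def)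
  \<comment> \<open>The coefficients of \<open>M\<close> sum to the total stepsize, so division by
    \<open>c\<close> makes them convex weights.\<close>
  have "W + W1 + W2 = c" by (simp add: W_def W1_def W2_def c_def field_simps)
  then have W: "W / c + W1 / c + W2 / c = 1" using c by (simp flip: add_divide_distrib)
  have "0 \<le> W" "0 \<le> W1" "0 \<le> W2" using \<eta> k by (auto simp: W_def W1_def W2_def)
  then have W': "0 \<le> W / c" "0 \<le> W1 / c" "0 \<le> W2 / c" using c by auto
  have "F0 \<le> inner ((W / c) *\<^sub>R G0 + (W1 / c) *\<^sub>R G1 + (W2 / c) *\<^sub>R G2) X + 100 * d"
    unfolding d_def using \<eta> by (intro value_upper_bound[OF _ _ _ _ W' W M0 M1 M2 Q10 Q20]) auto
  also have "(W / c) *\<^sub>R G0 + (W1 / c) *\<^sub>R G1 + (W2 / c) *\<^sub>R G2 = (1 / c) *\<^sub>R M"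
    by (simp add: M_def scaleR_add_right)
  finally have "c * F0 \<le> c * (inner M X / c + 100 * d)"
    using c by (intro mult_left_mono) auto
  then have "c * F0 \<le> inner M X + 100 * c * d" using c by (simp add: algebra_simps)
  also have "inner M X \<le> norm M * D"
    using D by (meson Cauchy_Schwarz_ineq2 abs_le_iff mult_left_mono norm_ge_zero order_trans)
  finally have upper: "c * F0 - 100 * c * d \<le> norm M * D" by simp
  \<comment> \<open>The threshold \<open>\<eta> / 10 ^ 7\<close> on \<open>F0\<close> is used here:
    200 * 81/4 / 10^7 is below 1/1600.\<close>
  have "c\<^sup>2 \<le> (9 / 2)\<^sup>2" using c by (intro power_mono) auto
  then have "c\<^sup>2 * (200 * F0) \<le> (9 / 2)\<^sup>2 * (200 * F0)" using F0 by (intro mult_right_mono) auto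
  also have "\<dots> \<le> D\<^sup>2 * \<eta> / 1600" 
    using F0 \<eta> D mult_pos_pos[of "D\<^sup>2" \<eta>] by (simp add: power2_eq_square)
  finally have "c\<^sup>2 * (200 * F0) * d \<le> D\<^sup>2 * \<eta> / 1600 * d"
    using d by (intro mult_right_mono) auto
  then have small: "200 * (c\<^sup>2 * F0 * d) \<le> D\<^sup>2 * (\<eta> / 1600 * d)" by (simp add: algebra_simps)
  have "(c * F0)\<^sup>2 \<le> D\<^sup>2 * ((norm M)\<^sup>2 + \<eta> / 1600 * d)"
  \<comment> \<open>If \<open>F0 \<le> 100 * d\<close>, the left side of \<open>upper\<close> need
    not be nonnegative and cannot be squared, but then the \<open>d\<close> term alone
    dominates.\<close>
  proof (cases "F0 \<le> 100 * d")
    case True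
    then have "c\<^sup>2 * F0 * F0 \<le> c\<^sup>2 * F0 * (200 * d)"
      using d F0 by (intro mult_left_mono) auto
    then have "(c * F0)\<^sup>2 \<le> D\<^sup>2 * (\<eta> / 1600 * d)"
      using small by (simp add: power2_eq_square algebra_simps)
    also have "\<dots> \<le> D\<^sup>2 * ((norm M)\<^sup>2 + \<eta> / 1600 * d)" by (intro mult_left_mono) auto
    finally show ?thesis .
  next
    case False
    then have "0 \<le> c * (F0 - 100 * d)" using c by (intro mult_nonneg_nonneg) auto
    then have "(c * F0 - 100 * c * d)\<^sup>2 \<le> (norm M * D)\<^sup>2"
      using upper by (intro power_mono) (auto simp: algebra_simps)
    moreover have "(c * F0 - 100 * c * d)\<^sup>2 = (c * F0)\<^sup>2 - 200 * (c\<^sup>2 * F0 * d) + (100 * c * d)\<^sup>2"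
      by (simp add: power2_eq_square algebra_simps)
    ultimately have "(c * F0)\<^sup>2 \<le> (norm M * D)\<^sup>2 + 200 * (c\<^sup>2 * F0 * d)"
      using zero_le_power2[of "100 * c * d"] by linarith
    then show ?thesis using small by (simp add: power_mult_distrib algebra_simps)
  qed
  also have "\<dots> \<le> D\<^sup>2 * (c * (F0 - F2))" using lower by (intro mult_left_mono) auto
  finally have "c * (c * F0\<^sup>2) \<le> c * (D\<^sup>2 * (F0 - F2))"
    by (simp add: power2_eq_square algebra_simps)
  then have "c * F0\<^sup>2 \<le> D\<^sup>2 * (F0 - F2)" using c by simp
  then have "c / D\<^sup>2 * F0\<^sup>2 \<le> F0 - F2" using D by (simp add: divide_simps mult.commute)
  then show ?thesis by (simp add: c_def)
qed

section \<open>Convex smooth functions on \<open>Rn n\<close>\<close>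

lemma Rn_diff: "x \<in> Rn n \<Longrightarrow> y \<in> Rn n \<Longrightarrow> x - y \<in> Rn n"
  and Rn_add: "x \<in> Rn n \<Longrightarrow> y \<in> Rn n \<Longrightarrow> x + y \<in> Rn n"
  and Rn_scale: "x \<in> Rn n \<Longrightarrow> r *\<^sub>R x \<in> Rn n"
  by (simp_all add: Rn_def)

lemma is_gradient_grad:
  assumes "L_smooth n L f" "x \<in> Rn n"
  shows "is_gradient n f x (grad n f x)"
  using assms grad_eqI unfolding L_smooth_def by metis

lemma grad_in_Rn: "L_smooth n L f \<Longrightarrow> x \<in> Rn n \<Longrightarrow> grad n f x \<in> Rn n"
  using is_gradient_grad by (auto simp: is_gradient_def)

text \<open>The line stays inside \<open>Rn n\<close>, so the derivative within \<open>Rn n\<close>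
  restricts to an ordinary derivative in the real parameter.\<close>

lemma DERIV_along_line:
  assumes "L_smooth n L f" "x \<in> Rn n" "d \<in> Rn n"
  shows "((\<lambda>t. f (x + t *\<^sub>R d)) has_real_derivative inner (grad n f (x + t *\<^sub>R d)) d) (at t)"
proof -
  let ?g = "grad n f (x + t *\<^sub>R d)"
  have line: "((\<lambda>t. x + t *\<^sub>R d) has_derivative (\<lambda>t. t *\<^sub>R d)) (at t)"
    by (auto intro!: derivative_eq_intros)
  have "x + t *\<^sub>R d \<in> Rn n" "range (\<lambda>t. x + t *\<^sub>R d) \<subseteq> Rn n"
    using assms by (auto intro: Rn_add Rn_scale)
  then have "(f has_derivative (\<lambda>v. inner ?g v)) (at (x + t *\<^sub>R d) within range (\<lambda>t. x + t *\<^sub>R d))"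
    using is_gradient_grad[OF assms(1)] has_derivative_subset unfolding is_gradient_def by blast
  from diff_chain_within[OF line this]
  show ?thesis
    by (simp add: o_def has_field_derivative_def mult_commute_abs)
qed

text \<open>Restriction to the line through \<open>x\<close> and \<open>y\<close> reduces this to a
  convex function of one real variable.\<close>

lemma convex_above_tangent:
  assumes "convex_on (Rn n) f" "L_smooth n L f" "x \<in> Rn n" "y \<in> Rn n"
  shows "f x + inner (grad n f x) (y - x) \<le> f y"
proof -
  define \<phi> where "\<phi> t = f (x + t *\<^sub>R (y - x))" for t
  have "convex_on UNIV \<phi>"
  proof (rule convex_onI)
    fix t u v :: real
    assume t: "0 < t" "t < 1"
    have "x + ((1 - t) *\<^sub>R u + t *\<^sub>R v) *\<^sub>R (y - x)
        = (1 - t) *\<^sub>R (x + u *\<^sub>R (y - x)) + t *\<^sub>R (x + v *\<^sub>R (y - x))"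
      by (simp add: algebra_simps)
    then show "\<phi> ((1 - t) *\<^sub>R u + t *\<^sub>R v) \<le> (1 - t) * \<phi> u + t * \<phi> v"
      unfolding \<phi>_def using assms t
      by (metis Rn_add Rn_diff Rn_scale convex_onD less_imp_le)
  qed simp
  moreover have "(\<phi> has_real_derivative inner (grad n f x) (y - x)) (at 0)"
    using DERIV_along_line[OF assms(2,3), of "y - x" 0] assms by (simp add: \<phi>_def[abs_def] Rn_diff)
  ultimately have "inner (grad n f x) (y - x) * (1 - 0) \<le> \<phi> 1 - \<phi> 0"
    by (intro convex_on_imp_above_tangent[of UNIV \<phi> 0 1]) auto
  then show ?thesis by (simp add: \<phi>_def)
qed

text \<open>Along the segment, \<open>f\<close> minus its linear part and the quadratic term has
  nonpositive derivative, because the gradient is Lipschitz.\<close>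

lemma descent_lemma:
  assumes "L_smooth n L f" "x \<in> Rn n" "y \<in> Rn n"
  shows "f y \<le> f x + inner (grad n f x) (y - x) + L / 2 * (norm (y - x))\<^sup>2"
proof -
  define d where "d = y - x"
  have d: "d \<in> Rn n" using assms by (simp add: d_def Rn_diff)
  define \<phi> where "\<phi> t = f (x + t *\<^sub>R d) - t * inner (grad n f x) d - L * (norm d)\<^sup>2 * t\<^sup>2 / 2" for t
  have "\<phi> 1 \<le> \<phi> 0"
  proof (rule DERIV_nonpos_imp_nonincreasing[of 0 1 \<phi>])
    fix t :: real assume t: "0 \<le> t" "t \<le> 1"
    have "(\<phi> has_real_derivative
        (inner (grad n f (x + t *\<^sub>R d)) d - inner (grad n f x) d - L * (norm d)\<^sup>2 * t)) (at t)"
      unfolding \<phi>_def by (auto intro!: derivative_eq_intros DERIV_along_line[OF assms(1,2) d])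
    moreover have "dist (grad n f (x + t *\<^sub>R d)) (grad n f x) \<le> L * dist (x + t *\<^sub>R d) x"
      using assms d by (intro lipschitz_onD[of L "Rn n"]) (auto simp: L_smooth_def Rn_add Rn_scale)
    then have "norm (grad n f (x + t *\<^sub>R d) - grad n f x) \<le> L * (t * norm d)"
      using t by (simp add: dist_norm)
    then have "inner (grad n f (x + t *\<^sub>R d) - grad n f x) d \<le> L * (t * norm d) * norm d"
      by (meson Cauchy_Schwarz_ineq2 abs_le_iff mult_right_mono norm_ge_zero order_trans)
    ultimately show "\<exists>y. (\<phi> has_real_derivative y) (at t) \<and> y \<le> 0"
      by (force simp: inner_diff_left power2_eq_square algebra_simps)
  qed simp
  then show ?thesis by (simp add: \<phi>_def d_def)
qed

text \<open>The point \<open>z\<close> minimizes the gap between the quadratic upper bound based at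
  \<open>y\<close> and the tangent at \<open>x\<close>. Comparing both with \<open>f z\<close> gives
  the strongest inequality of this kind.\<close>

lemma L_smooth_interpolation:
  assumes "convex_on (Rn n) f" "L_smooth n L f" "x \<in> Rn n" "y \<in> Rn n"
  shows "f x + inner (grad n f x) (y - x) + (norm (grad n f x - grad n f y))\<^sup>2 / (2 * L) \<le> f y"
proof -
  define u where "u = grad n f y - grad n f x"
  define z where "z = y - (1 / L) *\<^sub>R u"
  have L: "0 < L" using assms by (simp add: L_smooth_def)
  have z: "z \<in> Rn n" using assms by (simp add: z_def u_def Rn_diff Rn_scale grad_in_Rn)
  have "f x + inner (grad n f x) (z - x) \<le> f z"
    by (rule convex_above_tangent) (use assms z in auto)
  also have "\<dots> \<le> f y + inner (grad n f y) (z - y) + L / 2 * (norm (z - y))\<^sup>2"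
    by (rule descent_lemma) (use assms z in auto)
  finally have "f x + inner (grad n f x) (y - x) + inner u u / L - L / 2 * (norm (z - y))\<^sup>2 \<le> f y"
    by (simp add: z_def u_def inner_simps algebra_simps diff_divide_distrib add_divide_distrib)
  also have "L / 2 * (norm (z - y))\<^sup>2 = inner u u / (2 * L)"
    using L by (simp add: z_def power_divide power2_eq_square power2_norm_eq_inner[symmetric])
  finally have "f x + inner (grad n f x) (y - x) + inner u u / (2 * L) \<le> f y" by simp
  also have "inner u u = (norm (grad n f x - grad n f y))\<^sup>2"
    by (simp add: u_def norm_minus_commute power2_norm_eq_inner[symmetric])
  finally show ?thesis .
qed

text \<open>A step of length \<open>1 / L\<close> along a nonzero negative gradient would go
  strictly below the minimum.\<close>

lemma grad_eq_0_if_minimizer: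
  assumes "L_smooth n L f" "xs \<in> Rn n" "\<forall>x\<in>Rn n. f xs \<le> f x"
  shows "grad n f xs = 0"
proof -
  let ?g = "grad n f xs"
  have L: "0 < L" using assms by (simp add: L_smooth_def)
  have z: "xs - (1 / L) *\<^sub>R ?g \<in> Rn n" using assms by (simp add: Rn_diff Rn_scale grad_in_Rn)
  have "f xs \<le> f (xs - (1 / L) *\<^sub>R ?g)" using assms z by blast
  also have "\<dots> \<le> f xs - (norm ?g)\<^sup>2 / (2 * L)"
    using descent_lemma[OF assms(1,2) z] L
    by (simp add: power_divide power2_norm_eq_inner[symmetric] power2_eq_square)
  finally show ?thesis using L by (simp add: divide_le_0_iff)
qed

section \<open>Gradient descent over one period\<close>

lemma gd_in_Rn:
  assumes "L_smooth n L f" "x \<in> Rn n"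
  shows "gd n L h f x k \<in> Rn n"
  by (induction k) (use assms in \<open>simp_all add: Rn_diff Rn_scale grad_in_Rn\<close>)

lemma gd_add: "gd n L h f x (m + k) = gd n L (\<lambda>i. h (m + i)) f (gd n L h f x m) k"
  by (induction k) simp_all

text \<open>Everything is divided by \<open>L\<close>, so that the interpolation inequalities become those of a
  1-smooth function.\<close>

lemma gd_two_step_decrease:
  fixes \<eta> :: real
  assumes \<eta>: "0 < \<eta>" "\<eta> < 3" and h: "h 0 = 3 - \<eta>" "h 1 = 3 / 2"
    and f: "convex_on (Rn n) f" "L_smooth n L f" and x: "x \<in> Rn n" "xs \<in> Rn n"
    and xs: "grad n f xs = 0" and D: "0 < D" "norm (x - xs) \<le> D"
    and small: "f x - f xs \<le> L * D\<^sup>2 * (\<eta> / 10 ^ 7)"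
  shows "f (gd n L h f x 2) - f xs \<le> (f x - f xs) - (9 / 2 - \<eta>) / (L * D\<^sup>2) * (f x - f xs)\<^sup>2"
proof -
  have L: "0 < L" using f by (simp add: L_smooth_def)
  define G where "G y = (1 / L) *\<^sub>R grad n f y" for y
  define F where "F y = (f y - f xs) / L" for y
  have Q: "inner (G v) (u - v) + (norm (G u - G v))\<^sup>2 / 2 \<le> F u - F v"
    if "u \<in> Rn n" "v \<in> Rn n" for u v
  proof -
    have "inner (grad n f v) (u - v) + (norm (grad n f v - grad n f u))\<^sup>2 / (2 * L) \<le> f u - f v"
      using L_smooth_interpolation[OF f that(2,1)] by simp
    then have "(inner (grad n f v) (u - v) + (norm (grad n f v - grad n f u))\<^sup>2 / (2 * L)) / L
        \<le> (f u - f v) / L"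
      using L by (intro divide_right_mono) auto
    moreover have "norm (G u - G v) = norm (grad n f v - grad n f u) / L"
      using L by (simp add: G_def norm_minus_commute flip: scaleR_diff_right)
    ultimately show ?thesis
      by (simp add: F_def G_def power_divide power2_eq_square add_divide_distrib diff_divide_distrib mult_ac)
  qed
  define x1 where "x1 = x - (3 - \<eta>) *\<^sub>R G x"
  define x2 where "x2 = x1 - (3 / 2) *\<^sub>R G x1"
  have G: "y \<in> Rn n \<Longrightarrow> G y \<in> Rn n" for y using f by (simp add: G_def Rn_scale grad_in_Rn)
  have x1: "x1 \<in> Rn n" using x G by (simp add: x1_def Rn_diff Rn_scale)
  have x2: "x2 \<in> Rn n" using x1 G by (simp add: x2_def Rn_diff Rn_scale)
  have s: "G xs = 0" "F xs = 0" by (simp_all add: G_def F_def xs)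
  have dec: "F x2 \<le> F x - (9 / 2 - \<eta>) / D\<^sup>2 * (F x)\<^sup>2"
  proof (rule two_step_decrease[OF \<eta> D])
    have "(norm (G x))\<^sup>2 / 2 \<le> F x" using Q[OF x(1,2)] s by simp
    then show "0 \<le> F x" using zero_le_power2[of "norm (G x)"] by linarith
    show "F x \<le> D\<^sup>2 * (\<eta> / 10 ^ 7)" using small L by (simp add: F_def field_simps)
    show "(3 - \<eta>) * inner (G x) (G x1) + (norm (G x - G x1))\<^sup>2 / 2 \<le> F x - F x1"
      using Q[OF x(1) x1] by (simp add: x1_def inner_commute)
    show "3 / 2 * inner (G x1) (G x2) + (norm (G x1 - G x2))\<^sup>2 / 2 \<le> F x1 - F x2"
      using Q[OF x1 x2] by (simp add: x2_def inner_commute)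
    show "inner (G x2) ((3 - \<eta>) *\<^sub>R G x + (3 / 2) *\<^sub>R G x1) + (norm (G x - G x2))\<^sup>2 / 2 \<le> F x - F x2"
      using Q[OF x(1) x2] by (simp add: x2_def x1_def add.commute)
    show "F x \<le> inner (G x) (x - xs) - (norm (G x))\<^sup>2 / 2"
      using Q[OF x(2,1)] s by (simp add: inner_diff_right)
    show "F x1 \<le> inner (G x1) (x - xs - (3 - \<eta>) *\<^sub>R G x) - (norm (G x1))\<^sup>2 / 2"
      using Q[OF x(2) x1] s by (simp add: inner_diff_right x1_def)
    show "F x2 \<le> inner (G x2) (x - xs - (3 - \<eta>) *\<^sub>R G x - (3 / 2) *\<^sub>R G x1) - (norm (G x2))\<^sup>2 / 2"
      using Q[OF x(2) x2] s by (simp add: inner_diff_right x2_def x1_def)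
    have "(norm (G x1 - G x))\<^sup>2 / 2 - (3 - \<eta>) * (norm (G x))\<^sup>2 \<le> F x1 - F x"
      using Q[OF x1 x(1)] by (simp add: x1_def power2_norm_eq_inner[symmetric])
    then show "F x \<le> F x1 + (3 - \<eta>) * (norm (G x))\<^sup>2"
      using zero_le_power2[of "norm (G x1 - G x)"] by linarith
    have "(norm (G x2 - G x))\<^sup>2 / 2 - inner (G x) ((3 - \<eta>) *\<^sub>R G x + (3 / 2) *\<^sub>R G x1) \<le> F x2 - F x"
      using Q[OF x2 x(1)] by (simp add: x2_def x1_def inner_simps)
    then show "F x \<le> F x2 + inner (G x) ((3 - \<eta>) *\<^sub>R G x + (3 / 2) *\<^sub>R G x1)"
      using zero_le_power2[of "norm (G x2 - G x)"] by linarith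
  qed
  have "gd n L h f x 2 = x2"
    by (simp add: numeral_2_eq_2 x2_def x1_def G_def h[unfolded One_nat_def])
  moreover define A where "A = f x - f xs"
  have "F x - k / D\<^sup>2 * (F x)\<^sup>2 = (A - k / (L * D\<^sup>2) * A\<^sup>2) / L" for k
    by (simp add: F_def A_def[symmetric] diff_divide_distrib power2_eq_square)
  with dec have "(f x2 - f xs) / L \<le> (A - (9 / 2 - \<eta>) / (L * D\<^sup>2) * A\<^sup>2) / L"
    by (simp add: F_def)
  then have "f x2 - f xs \<le> A - (9 / 2 - \<eta>) / (L * D\<^sup>2) * A\<^sup>2"
    using L by (simp only: divide_le_cancel)
  ultimately show ?thesis by (simp add: A_def)
qed

section \<open>Straightforwardness of the pattern\<close>

text \<open>The two-step bound concerns the actual initial gap \<open>e\<close>. It passes to every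
  larger \<open>\<delta>\<close> below the threshold because the bound increases with the gap
  there.\<close>

lemma straightforward_long_short:
  fixes \<eta> :: real
  assumes \<eta>: "0 < \<eta>" "\<eta> < 3"
  shows "straightforward [3 - \<eta>, 3 / 2]"
  unfolding straightforward_def
proof (intro exI[of _ "\<eta> / 10 ^ 7"] conjI allI impI ballI)
  fix m :: nat and L D \<delta> :: real
  assume L: "0 < L" and D: "0 < D" and \<delta>: "\<delta> \<in> {0..L * D\<^sup>2 * (\<eta> / 10 ^ 7)}"
  let ?h = "[3 - \<eta>, 3 / 2]"
  define K where "K = (9 / 2 - \<eta>) / (L * D\<^sup>2)"
  have K: "(\<Sum>i<length ?h. ?h ! i) / (L * D\<^sup>2) = K"
    by (simp add: K_def numeral_2_eq_2)
  have LD: "0 < L * D\<^sup>2" using L D by simp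
  have "K * \<delta> \<le> K * (L * D\<^sup>2 * (\<eta> / 10 ^ 7))"
    using \<delta> LD \<eta> by (intro mult_left_mono) (auto simp: K_def)
  also have "\<dots> = (9 / 2 - \<eta>) * (\<eta> / 10 ^ 7)"
    using L D by (simp add: K_def)
  also have "\<dots> \<le> (9 / 2) * (3 / 10 ^ 7)"
    using \<eta> by (intro mult_mono) auto
  also have "\<dots> \<le> 1 / 2" by simp
  finally have K\<delta>: "K * \<delta> \<le> 1 / 2" .
  have K0: "0 \<le> K" using LD \<eta> by (simp add: K_def)
  show "worst_case m ?h L D \<delta> \<le> ereal (\<delta> - (\<Sum>i<length ?h. ?h ! i) / (L * D\<^sup>2) * \<delta>\<^sup>2)"
    unfolding worst_case_def K
  proof (rule Sup_least)
    fix y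
    assume "y \<in> {ereal (f (gd m L (\<lambda>k. ?h ! k) f x0 (length ?h)) - f xs) | f x0 xs.
      convex_on (Rn m) f \<and> L_smooth m L f \<and> x0 \<in> Rn m \<and> xs \<in> Rn m \<and>
      grad m f xs = 0 \<and> norm (x0 - xs) \<le> D \<and> f x0 - f xs \<le> \<delta>}"
    then obtain f x0 xs where y: "y = ereal (f (gd m L (\<lambda>k. ?h ! k) f x0 (length ?h)) - f xs)"
      and f: "convex_on (Rn m) f" "L_smooth m L f" and x: "x0 \<in> Rn m" "xs \<in> Rn m"
      and xs: "grad m f xs = 0" and n: "norm (x0 - xs) \<le> D" and le: "f x0 - f xs \<le> \<delta>"
      by blast
    define e where "e = f x0 - f xs"
    have e: "0 \<le> e" using L_smooth_interpolation[OF f x(2,1)] xs L 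
      by (simp add: e_def) (smt (verit) divide_nonneg_pos zero_le_power2)
    have "f (gd m L (\<lambda>k. ?h ! k) f x0 2) - f xs \<le> e - K * e\<^sup>2"
      unfolding e_def K_def
      by (rule gd_two_step_decrease[OF \<eta> _ _ f x xs D n]) (use le \<delta> in auto)
    \<comment> \<open>The difference of the two sides factors as
      \<open>(\<delta> - e) * (1 - K * (\<delta> + e))\<close>, and
      \<open>K * \<delta> \<le> 1 / 2\<close> makes the second factor nonnegative.\<close>
    also have "\<dots> \<le> \<delta> - K * \<delta>\<^sup>2"
    proof -
      have "K * (\<delta> + e) \<le> K * (\<delta> + \<delta>)"
        using le K0 by (intro mult_left_mono) (auto simp: e_def)
      then have "0 \<le> (\<delta> - e) * (1 - K * (\<delta> + e))"
        using K\<delta> le by (intro mult_nonneg_nonneg) (auto simp: e_def algebra_simps)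
      then show ?thesis by (simp add: algebra_simps power2_eq_square)
    qed
    finally show "y \<le> ereal (\<delta> - K * \<delta>\<^sup>2)"
      by (simp add: y numeral_2_eq_2)
  qed
qed (use \<eta> in auto)

section \<open>Convergence rate from the repeated pattern\<close>

text \<open>While \<open>E s > \<Delta>\<close> the sequence drops by a fixed amount in every step, so this phase lasts
  boundedly many steps; afterwards \<open>1 / E\<close> grows by at least \<open>c\<close> per step.\<close>

lemma quadratic_recursion_bound:
  fixes E :: "nat \<Rightarrow> real"
  assumes c: "0 < c" "c * \<Delta> \<le> 1" and \<Delta>: "0 < \<Delta>"
    and E0: "\<And>s. 0 \<le> E s" "E 0 \<le> 1 / 2"
    and step: "\<And>s. E (Suc s) \<le> E s - c * E s * min (E s) \<Delta>"
    and N: "1 / (2 * c * \<Delta>\<^sup>2) \<le> real N" and s: "N \<le> s"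
  shows "E s * (c * (real s - real N)) \<le> 1"
proof -
  have phase1: "E s \<le> 1 / 2 - c * \<Delta>\<^sup>2 * real s \<or> E s \<le> \<Delta>" for s
  proof (induction s)
    case (Suc s)
    have dec: "E (Suc s) \<le> E s"
      using step[of s] c \<Delta> E0(1)[of s] by (smt (verit) mult_nonneg_nonneg)
    show ?case
    proof (cases "E s \<le> \<Delta>")
      case False
      then have "c * \<Delta> * \<Delta> \<le> c * E s * min (E s) \<Delta>"
        using c \<Delta> by (intro mult_mono) auto
      then show ?thesis using Suc False step[of s] by (auto simp: power2_eq_square algebra_simps)
    qed (use dec in auto)
  qed (use E0 in simp)
  \<comment> \<open>At this \<open>N\<close> the linear bound in \<open>phase1\<close> has come down
    to 0, so both alternatives give \<open>E N \<le> \<Delta>\<close>.\<close>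
  have "1 \<le> 2 * c * \<Delta>\<^sup>2 * real N" using N c \<Delta> by (simp add: field_simps)
  then have N\<Delta>: "E N \<le> \<Delta>" using phase1[of N] \<Delta> by linarith
  \<comment> \<open>This is the product form of \<open>1 / E \<ge> c * k\<close>, meaningful also
    when \<open>E\<close> vanishes. The second conjunct keeps the minimum in \<open>step\<close>
    equal to \<open>E\<close>.\<close>
  have "E (N + k) * (c * real k) \<le> 1 \<and> E (N + k) \<le> \<Delta>" for k
  proof (induction k)
    case (Suc k)
    define e where "e = E (N + k)"
    have e: "0 \<le> e" "e \<le> \<Delta>" "e * (c * real k) \<le> 1" using Suc E0 by (auto simp: e_def)
    have st: "E (N + Suc k) \<le> e - c * e\<^sup>2"
      using step[of "N + k"] e by (simp add: e_def[symmetric] power2_eq_square mult.assoc)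
    have "c * e \<le> c * \<Delta>" using e c by (intro mult_left_mono) auto
    then have ce: "c * e \<le> 1" using c by linarith
    have "E (N + Suc k) * (c * real (Suc k)) \<le> (e - c * e\<^sup>2) * (c * real (Suc k))"
      using st c by (intro mult_right_mono) auto
    also have "\<dots> = (1 - c * e) * (e * (c * real k)) + (1 - c * e) * (c * e)"
      by (simp add: power2_eq_square algebra_simps)
    also have "\<dots> \<le> (1 - c * e) * 1 + (1 - c * e) * (c * e)"
      using ce e by (intro add_right_mono mult_left_mono) auto
    also have "\<dots> = 1 - (c * e)\<^sup>2"
      by (simp add: power2_eq_square algebra_simps)
    also have "\<dots> \<le> 1" by simp
    finally show ?case using st e c by (smt (verit) mult_nonneg_nonneg zero_le_power2)
  qed (use N\<Delta> in simp)
  from this[of "s - N"] show ?thesis using s by (simp add: of_nat_diff)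
qed

text \<open>For the rate, the gap after each period, divided by \<open>L * D\<^sup>2\<close>,
  satisfies the quadratic recursion. It starts at most at 1/2 by the descent lemma at the
  minimizer.\<close>

theorem theorem3p2:
  fixes \<eta> :: real and h :: "real list"
  assumes "0 < \<eta>" and "\<eta> < 3"
    and "h = [3 - \<eta>, 3 / 2]"
  shows "straightforward h \<and>
    (\<exists>(s_bar::nat) (C::real). \<forall>n\<ge>1. \<forall>L>0. \<forall>f x0 xs D.
      convex_on (Rn n) f \<longrightarrow> L_smooth n L f \<longrightarrow>
      xs \<in> Rn n \<longrightarrow> (\<forall>x\<in>Rn n. f xs \<le> f x) \<longrightarrow> x0 \<in> Rn n \<longrightarrow>
      bdd_above {norm (x - xs) | x. x \<in> Rn n \<and> f x \<le> f x0} \<longrightarrow>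
      D = Sup {norm (x - xs) | x. x \<in> Rn n \<and> f x \<le> f x0} \<longrightarrow>
      (\<forall>s>s_bar. \<forall>T. T = 2 * s \<longrightarrow>
        f (gd n L (\<lambda>k. h ! (k mod 2)) f x0 T) - f xs
          \<le> L * D\<^sup>2 / ((9 / 4 - \<eta> / 2) * real T - C)))"
proof
  show "straightforward h" using assms straightforward_long_short by simp
next
  note \<eta> = assms(1,2)
  define c where "c = 9 / 2 - \<eta>"
  define \<Delta> where "\<Delta> = \<eta> / 10 ^ 7"
  \<comment> \<open>\<open>N\<close> depends on \<open>\<eta>\<close> alone, which makes both
    constants universal.\<close>
  obtain N :: nat where N: "1 / (2 * c * \<Delta>\<^sup>2) \<le> real N" using real_arch_simple by blast
  have \<Delta>: "0 < \<Delta>" using \<eta> by (simp add: \<Delta>_def)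
  have "c * \<Delta> \<le> (9 / 2) * (3 / 10 ^ 7)"
    unfolding c_def \<Delta>_def using \<eta> by (intro mult_mono) auto
  then have c: "0 < c" "c * \<Delta> \<le> 1" using \<eta> by (auto simp: c_def)
  let ?h = "\<lambda>k. h ! (k mod 2)"
  show "\<exists>(s_bar::nat) (C::real). \<forall>n\<ge>1. \<forall>L>0. \<forall>f x0 xs D.
      convex_on (Rn n) f \<longrightarrow> L_smooth n L f \<longrightarrow>
      xs \<in> Rn n \<longrightarrow> (\<forall>x\<in>Rn n. f xs \<le> f x) \<longrightarrow> x0 \<in> Rn n \<longrightarrow>
      bdd_above {norm (x - xs) | x. x \<in> Rn n \<and> f x \<le> f x0} \<longrightarrow>
      D = Sup {norm (x - xs) | x. x \<in> Rn n \<and> f x \<le> f x0} \<longrightarrow>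
      (\<forall>s>s_bar. \<forall>T. T = 2 * s \<longrightarrow>
        f (gd n L ?h f x0 T) - f xs \<le> L * D\<^sup>2 / ((9 / 4 - \<eta> / 2) * real T - C))"
  \<comment> \<open>\<open>C\<close> is \<open>c * real N\<close> because \<open>c\<close> per
    period of two steps is \<open>c / 2 = 9 / 4 - \<eta> / 2\<close> per step. For
    \<open>s > N\<close> the denominator is positive.\<close>
  proof (intro exI[of _ N] exI[of _ "c * real N"] allI impI)
    fix n s T :: nat and L D :: real and f x0 xs
    assume L: "0 < L" and f: "convex_on (Rn n) f" "L_smooth n L f" and xs: "xs \<in> Rn n"
      and min: "\<forall>x\<in>Rn n. f xs \<le> f x" and x0: "x0 \<in> Rn n"
      and bdd: "bdd_above {norm (x - xs) | x. x \<in> Rn n \<and> f x \<le> f x0}"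
      and D_def: "D = Sup {norm (x - xs) | x. x \<in> Rn n \<and> f x \<le> f x0}"
      and s: "N < s" and T: "T = 2 * s"
    have xs0: "grad n f xs = 0" using f xs min by (intro grad_eq_0_if_minimizer)
    have D: "norm (x - xs) \<le> D" if "x \<in> Rn n" "f x \<le> f x0" for x
      unfolding D_def by (rule cSup_upper[OF _ bdd]) (use that in blast)
    have D0: "0 \<le> D" using D[OF x0] norm_ge_zero[of "x0 - xs"] by linarith
    define x where "x s = gd n L ?h f x0 (2 * s)" for s
    define e where "e s = f (x s) - f xs" for s
    have xR: "x s \<in> Rn n" for s using f x0 by (simp add: x_def gd_in_Rn)
    have e0: "0 \<le> e s" for s using min xR by (simp add: e_def)
    \<comment> \<open>The shift by the even index \<open>2 * s\<close> leaves the periodic stepsizes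
      unchanged.\<close>
    have x_Suc: "x (Suc s) = gd n L ?h f (x s) 2" for s
      using gd_add[of n L ?h f x0 "2 * s" 2] by (simp add: x_def add.commute)
    have period: "e (Suc s) \<le> e s - c / (L * D'\<^sup>2) * (e s)\<^sup>2"
      if "0 < D'" "norm (x s - xs) \<le> D'" "e s \<le> L * D'\<^sup>2 * \<Delta>" for s D'
      unfolding e_def x_Suc c_def
      by (rule gd_two_step_decrease[OF \<eta> _ _ f xR xs xs0 that(1,2)])
        (use that(3) assms(3) in \<open>simp_all add: e_def \<Delta>_def\<close>)
    have growth: "e s \<le> L / 2 * (norm (x s - xs))\<^sup>2" for s
      using descent_lemma[OF f(2) xs xR[of s]] xs0 by (simp add: e_def)
    show "f (gd n L ?h f x0 T) - f xs \<le> L * D\<^sup>2 / ((9 / 4 - \<eta> / 2) * real T - c * real N)"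
    \<comment> \<open>For \<open>D = 0\<close> normalising by \<open>L * D\<^sup>2\<close> is
      impossible. The start is then the minimizer, the iterates stay there, and both sides are
      0.\<close>
    proof (cases "D = 0")
      case True
      have "x s = xs" for s
      proof (induction s)
        case 0
        then show ?case using D[OF x0] True by (simp add: x_def)
      next
        case (Suc s)
        then show ?case using xs0 by (simp add: x_Suc numeral_2_eq_2)
      qed
      then show ?thesis using True by (simp add: x_def[symmetric] T)
    next
      case False
      with D0 have D_pos: "0 < D" by simp
      define E where "E s = e s / (L * D\<^sup>2)" for s
      have LD: "0 < L * D\<^sup>2" using L D_pos by simp
      have eE: "e s = L * D\<^sup>2 * E s" for s using L D_pos by (simp add: E_def)
      \<comment> \<open>If the gap is too large for \<open>D\<close>, the two-step bound applies with the larger radius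
        \<open>D'\<close> given by \<open>e s = L * D'\<^sup>2 * \<Delta>\<close>.\<close>
      have step_if: "e (Suc s) \<le> e s - c * e s * min (E s) \<Delta>" if "e s \<le> e 0" for s
      proof -
        have xD: "norm (x s - xs) \<le> D" using that xR by (intro D) (auto simp: e_def x_def)
        show ?thesis
        proof (cases "E s \<le> \<Delta>")
          case True
          then have "e s \<le> L * D\<^sup>2 * \<Delta>" unfolding eE using LD by (intro mult_left_mono) auto
          from period[OF D_pos xD this] show ?thesis
            using True by (simp add: E_def power2_eq_square)
        next
          case False
          define D' where "D' = sqrt (e s / (L * \<Delta>))"
          have es: "L * D\<^sup>2 * \<Delta> < e s"
            unfolding eE using False LD by (intro mult_strict_left_mono) auto
          then have "0 < e s" using LD \<Delta> by (smt (verit) mult_pos_pos)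
          have "D\<^sup>2 \<le> e s / (L * \<Delta>)" using es L \<Delta> by (simp add: field_simps)
          then have DD': "D \<le> D'" by (simp add: D'_def real_le_rsqrt)
          have sq: "D'\<^sup>2 = e s / (L * \<Delta>)" using \<open>0 < e s\<close> L \<Delta> by (simp add: D'_def)
          have "e (Suc s) \<le> e s - c / (L * D'\<^sup>2) * (e s)\<^sup>2"
            using DD' D_pos xD L \<Delta> by (intro period) (auto simp: sq)
          also have "c / (L * D'\<^sup>2) * (e s)\<^sup>2 = c * e s * \<Delta>"
            unfolding sq using \<open>0 < e s\<close> L \<Delta> by (simp add: power2_eq_square)
          finally show ?thesis using False by simp
        qed
      qed
      have E0: "0 \<le> E s" for s using e0 LD by (simp add: E_def)
      \<comment> \<open>The premise of \<open>step_if\<close> puts \<open>x s\<close> in the initial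
        sublevel set, hence within \<open>D\<close> of \<open>xs\<close>. This induction supplies it
        for every period.\<close>
      have mono: "e s \<le> e 0" for s
      proof (induction s)
        case (Suc s)
        have "0 \<le> c * e s * min (E s) \<Delta>" using c e0 E0 \<Delta> by simp
        then show ?case using step_if[OF Suc] Suc by linarith
      qed simp
      have "E (Suc s) \<le> E s - c * E s * min (E s) \<Delta>" for s
        using divide_right_mono[OF step_if[OF mono] less_imp_le[OF LD], of s]
        by (simp add: E_def diff_divide_distrib)
      moreover have "E 0 \<le> 1 / 2"
      proof -
        have "e 0 \<le> L / 2 * (norm (x 0 - xs))\<^sup>2" by (rule growth)
        also have "\<dots> \<le> L / 2 * D\<^sup>2"
          using D[OF x0] L by (intro mult_left_mono power_mono) (auto simp: x_def)
        finally show ?thesis using LD by (simp add: E_def field_simps)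
      qed
      ultimately have "E s * (c * (real s - real N)) \<le> 1"
        using s by (intro quadratic_recursion_bound[OF c \<Delta> E0 _ _ N]) auto
      then have "e s * (c * (real s - real N)) \<le> L * D\<^sup>2"
        using LD by (simp add: E_def divide_le_eq)
      then have "e s \<le> L * D\<^sup>2 / (c * (real s - real N))"
        using s c by (simp add: pos_le_divide_eq)
      also have "c * (real s - real N) = (9 / 4 - \<eta> / 2) * real T - c * real N"
        by (simp add: T c_def field_simps)
      finally show ?thesis by (simp add: e_def x_def T)
    qed
  qed
qed

end
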